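(* For $K\ge N$, there is a symmetric matrix $H_K\in\mathbb{R}^{((K+2)n+m)\times((K+2)n+m)}$, not depending on $x_k$, $u_k$ or the reference values, such that $${}^{K}Q_0=\tfrac12\,\begin{bmatrix}x_k^\top & u_k^\top & r_k^\top & \cdots & r_{k+N}^\top & 0^\top\end{bmatrix} H_K \begin{bmatrix}x_k^\top & u_k^\top & r_k^\top & \cdots & r_{k+N}^\top & 0^\top\end{bmatrix}^\top ,$$ where the trailing zero vector has dimension $(K-N)n$. Partitioning $H_K$ into blocks $h_{ab}$ according to the components $a,b\in\{x,u,r_0,r_1,\dots,r_K\}$ (of sizes $n,m,n,\dots,n$), the blocks have the following zero pattern: $h_{u r_0}=h_{r_0u}^\top=0$; $h_{r_0 r_j}=0$ for all $j\ge1$; $h_{r_1 r_j}=0$ for all $j\neq1$; and $h_{r_i r_0}=h_{r_i r_1}=0$ for all $i\ge2$. All other blocks ($h_{xx},h_{xu},h_{xr_j},h_{uu},h_{ur_j}$ for $j\ge1$, $h_{r_0r_0}$, $h_{r_1r_1}$, and $h_{r_ir_j}$ for $i,j\ge2$, together with their transposes) may be nonzero.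
   Context: Consider the discrete-time linear system $x_{i+1}=Ax_i+Bu_i$ with $x_i\in\mathbb{R}^n$, $u_i\in\mathbb{R}^m$, $A\in\mathbb{R}^{n\times n}$, $B\in\mathbb{R}^{n\times m}$, $(A,B)$ controllable. Fix a time step $k$ and $N\in\mathbb{N}$; references $r_i\in\mathbb{R}^n$ are given for $i=k,\dots,k+N$ and $r_i=0$ for $i>k+N$. The one-step cost is $c_i=\tfrac12\big((x_i-r_i)^\top Q(x_i-r_i)+u_i^\top Ru_i\big)$ with $Q=Q^\top\succeq0$, $R=R^\top\succ0$, and $\gamma\in[0,1)$. For an optimization horizon $K$, the reference-dependent Q-function is defined by backward recursion: ${}^{K}Q_K=c(x_{k+K},u_{k+K},r_{k+K})$ and, for $0\le\kappa<K$, ${}^{K}Q_\kappa=c_{k+\kappa}+\gamma\,{}^{K}Q_{\kappa+1}|_{u_{k+\kappa+1}=u^*_{k+\kappa+1}}$, where $x_{k+\kappa+1}=Ax_{k+\kappa}+Bu_{k+\kappa}$ and $u^*_{k+\kappa+1}$ minimizes ${}^{K}Q_{\kappa+1}$ over $u_{k+\kappa+1}$. Thus ${}^{K}Q_0$ is a function of $x_k,u_k,r_k,\dots,r_{k+K}$. *)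

theory Defs
  imports "HOL-Analysis.Analysis"
begin

text \<open>Controllability of the pair (A,B): the columns of the Kalman controllability
  matrix [B, AB, ..., A^(n-1) B] span R^n (i.e. it has full rank n).\<close>
definition controllable :: "real^'n^'n \<Rightarrow> real^'m^'n \<Rightarrow> bool" where
  "controllable A B \<longleftrightarrow>
     span (\<Union>i<CARD('n). range (\<lambda>v. (((*v) A) ^^ i) (B *v v))) = UNIV"

definition psd :: "real^'n^'n \<Rightarrow> bool" where
  "psd M \<longleftrightarrow> transpose M = M \<and> (\<forall>v. 0 \<le> v \<bullet> (M *v v))"

definition pd :: "real^'n^'n \<Rightarrow> bool" where
  "pd M \<longleftrightarrow> transpose M = M \<and> (\<forall>v. v \<noteq> 0 \<longrightarrow> 0 < v \<bullet> (M *v v))"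

text \<open>One-step cost c(x,u,r).\<close>
definition cost :: "real^'n^'n \<Rightarrow> real^'m^'m \<Rightarrow> real^'n \<Rightarrow> real^'m \<Rightarrow> real^'n \<Rightarrow> real" where
  "cost Q R x u r = (1/2) * ((x - r) \<bullet> (Q *v (x - r)) + u \<bullet> (R *v u))"

text \<open>Qrec A B Q R \<gamma> d \<kappa> x u r is the Q-function (K)Q(kappa) with d = K - kappa remaining
  steps; x = x(k+kappa), u = u(k+kappa), and r j stands for r(k+j) (time shifted by k).\<close>
fun Qrec :: "real^'n^'n \<Rightarrow> real^'m^'n \<Rightarrow> real^'n^'n \<Rightarrow> real^'m^'m \<Rightarrow> real
              \<Rightarrow> nat \<Rightarrow> nat \<Rightarrow> real^'n \<Rightarrow> real^'m \<Rightarrow> (nat \<Rightarrow> real^'n) \<Rightarrow> real" where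
  "Qrec A B Q R \<gamma> 0 \<kappa> x u r = cost Q R x u (r \<kappa>)"
| "Qrec A B Q R \<gamma> (Suc d) \<kappa> x u r =
     (let x' = A *v x + B *v u;
          ustar = (SOME v. \<forall>w. Qrec A B Q R \<gamma> d (Suc \<kappa>) x' v r \<le> Qrec A B Q R \<gamma> d (Suc \<kappa>) x' w r)
      in cost Q R x u (r \<kappa>) + \<gamma> * Qrec A B Q R \<gamma> d (Suc \<kappa>) x' ustar r)"

text \<open>(K)Q(0) as a function of x_k, u_k and the references.\<close>
definition Q0 :: "real^'n^'n \<Rightarrow> real^'m^'n \<Rightarrow> real^'n^'n \<Rightarrow> real^'m^'m \<Rightarrow> real
              \<Rightarrow> nat \<Rightarrow> real^'n \<Rightarrow> real^'m \<Rightarrow> (nat \<Rightarrow> real^'n) \<Rightarrow> real" where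
  "Q0 A B Q R \<gamma> K x u r = Qrec A B Q R \<gamma> K 0 x u r"

text \<open>Block indices of the stacked vector [x; u; r_0; ...; r_K] of dimension (K+2)n+m:
  Bx i is entry i of the x-block, Bu j of the u-block, Br l i entry i of the r_l block.\<close>
datatype ('n, 'm) blk = Bx 'n | Bu 'm | Br nat 'n

definition blkset :: "nat \<Rightarrow> ('n, 'm) blk set" where
  "blkset K = range Bx \<union> range Bu \<union> {Br l i | l i. l \<le> K}"

fun stack :: "real^'n \<Rightarrow> real^'m \<Rightarrow> (nat \<Rightarrow> real^'n) \<Rightarrow> ('n, 'm) blk \<Rightarrow> real" where
  "stack x u r (Bx i) = x $ i"
| "stack x u r (Bu j) = u $ j"
| "stack x u r (Br l i) = r l $ i"

text \<open>z^T H z for a matrix H indexed by blkset K.\<close>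
definition qform :: "nat \<Rightarrow> (('n::finite, 'm::finite) blk \<Rightarrow> ('n, 'm) blk \<Rightarrow> real) \<Rightarrow> (('n, 'm) blk \<Rightarrow> real) \<Rightarrow> real" where
  "qform K H z = (\<Sum>a\<in>blkset K. \<Sum>b\<in>blkset K. z a * H a b * z b)"

end

(*
  By backward induction every Q-function is a quadratic form in the state, the references and
  the input, positive definite in the input alone. Minimising such a form over the input gives
  a minimiser that is linear in the other variables, so substituting it keeps the value
  quadratic. Hence Q0 is a quadratic form on the stacked vector [x; u; r_0; ...; r_K], and
  H_K is its Hessian, read off as second differences along the coordinate vectors.

  A block h_ab vanishes as soon as Q0 splits into a summand invariant in direction a and one
  invariant in direction b. The reference r_0 enters only through the stage cost
  (x - r_0)' Q (x - r_0); the reference r_1 enters only through the next tracking cost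
  (A x + B u - r_1)' Q (A x + B u - r_1), because it shifts the next Q-function by an amount
  independent of the next input and so does not move the minimiser.
*)
theory Submission
  imports Defs "HOL-Library.Function_Algebras"
begin

(* Reference sequences form a vector space pointwise, so Q0 is a function on a vector space. *)
instantiation "fun" :: (type, real_vector) real_vector
begin
definition scaleR_fun :: "real \<Rightarrow> ('a \<Rightarrow> 'b) \<Rightarrow> 'a \<Rightarrow> 'b" where
  "scaleR_fun c f = (\<lambda>x. c *\<^sub>R f x)"
instance by standard (auto simp: scaleR_fun_def fun_eq_iff algebra_simps)
end

lemma scaleR_fun_apply [simp]: "(c *\<^sub>R f) x = c *\<^sub>R f x"
  by (simp add: scaleR_fun_def)

lemma sum_fun_apply: "(sum f S :: 'a \<Rightarrow> 'b::real_vector) x = (\<Sum>a\<in>S. f a x)"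
  by (induct S rule: infinite_finite_induct) auto

definition quadratic_form :: "('a::real_vector \<Rightarrow> real) \<Rightarrow> bool" where
  "quadratic_form q \<longleftrightarrow> (\<exists>b. bilinear b \<and> (\<forall>v. q v = b v v))"

lemma quadratic_formI: "bilinear b \<Longrightarrow> (\<And>v. q v = b v v) \<Longrightarrow> quadratic_form q"
  unfolding quadratic_form_def by blast

lemma quadratic_form_symmetric:
  assumes "quadratic_form q"
  obtains b where "bilinear b" "\<And>v w. b v w = b w v" "\<And>v. q v = b v v"
proof -
  obtain b where b: "bilinear b" "\<And>v. q v = b v v"
    using assms quadratic_form_def by blast
  have "bilinear (\<lambda>v w. (b v w + b w v) / 2)"
    using b(1) unfolding bilinear_def linear_iff by (auto simp: add_divide_distrib algebra_simps)
  with b(2) show thesis by (intro that[of "\<lambda>v w. (b v w + b w v) / 2"]) auto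
qed

lemma quadratic_form_compose:
  assumes "quadratic_form q" "linear f"
  shows "quadratic_form (\<lambda>v. q (f v))"
proof -
  obtain b where b: "bilinear b" "\<And>v. q v = b v v"
    using assms(1) quadratic_form_def by blast
  have "bilinear (\<lambda>v w. b (f v) (f w))"
    using b(1) assms(2) unfolding bilinear_def linear_iff by auto
  then show ?thesis by (rule quadratic_formI) (simp add: b(2))
qed

lemma quadratic_form_add:
  assumes "quadratic_form q" "quadratic_form q'"
  shows "quadratic_form (\<lambda>v. q v + q' v)"
proof -
  obtain b b' where "bilinear b" "\<And>v. q v = b v v" "bilinear b'" "\<And>v. q' v = b' v v"
    using assms quadratic_form_def by metis
  then show ?thesis
    by (intro quadratic_formI[of "\<lambda>v w. b v w + b' v w"])
       (auto simp: bilinear_def linear_iff algebra_simps)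
qed

lemma quadratic_form_cmult:
  assumes "quadratic_form q"
  shows "quadratic_form (\<lambda>v. c * q v)"
proof -
  obtain b where "bilinear b" "\<And>v. q v = b v v"
    using assms quadratic_form_def by blast
  then show ?thesis
    by (intro quadratic_formI[of "\<lambda>v w. c * b v w"])
       (auto simp: bilinear_def linear_iff algebra_simps)
qed

lemma quadratic_form_matrix: "quadratic_form (\<lambda>x::real^'n. x \<bullet> (M *v x))"
  by (rule quadratic_formI[of "\<lambda>v w. v \<bullet> (M *v w)"])
     (auto simp: bilinear_def linear_iff inner_add_left inner_add_right
        matrix_vector_right_distrib matrix_vector_mult_scaleR)

lemma quadratic_form_partial_minimizer:
  fixes q :: "'v::real_vector \<times> 'u::euclidean_space \<Rightarrow> real"
  assumes "quadratic_form q" and pos: "\<And>u. u \<noteq> 0 \<Longrightarrow> 0 < q (0, u)"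
  obtains L where "linear L" "\<And>p u. u \<noteq> L p \<Longrightarrow> q (p, L p) < q (p, u)"
proof -
  obtain b where bil: "bilinear b" and sym: "\<And>v w. b v w = b w v" and qb: "\<And>v. q v = b v v"
    using quadratic_form_symmetric[OF assms(1)] by blast
  \<comment> \<open>Riesz representative of \<open>h \<mapsto> b z (0, h)\<close>; the minimiser makes it vanish.\<close>
  define \<rho> where "\<rho> z = (\<Sum>i\<in>Basis. b z (0, i) *\<^sub>R i)" for z
  have \<rho>_inner: "\<rho> z \<bullet> h = b z (0, h)" for z h
  proof -
    have lin: "linear (\<lambda>h. b z (0, h))"
    proof (rule linearI)
      show "b z (0, x + y) = b z (0, x) + b z (0, y)" for x y
        using bilinear_radd[OF bil, of z "(0, x)" "(0, y)"] by simp
      show "b z (0, c *\<^sub>R x) = c *\<^sub>R b z (0, x)" for c x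
        using bilinear_rmul[OF bil, of z c "(0, x)"] by simp
    qed
    have "b z (0, h) = b z (0, \<Sum>i\<in>Basis. (h \<bullet> i) *\<^sub>R i)"
      by (simp add: euclidean_representation)
    also have "\<dots> = (\<Sum>i\<in>Basis. (h \<bullet> i) * b z (0, i))"
      by (simp add: linear_sum[OF lin] linear_cmul[OF lin] o_def)
    finally show ?thesis
      by (simp add: \<rho>_def inner_sum_left inner_commute[of h] mult.commute)
  qed
  have lin_\<rho>: "linear \<rho>"
    using bil unfolding bilinear_def linear_iff
    by (auto simp: \<rho>_def sum.distrib scaleR_add_left scaleR_sum_right)
  define \<Phi> where "\<Phi> u = \<rho> (0, u)" for u
  have lin_\<Phi>: "linear \<Phi>"
  proof -
    have "linear (\<lambda>u::'u. (0::'v, u))" by (simp add: linear_iff)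
    from linear_compose[OF this lin_\<rho>] show ?thesis by (simp add: \<Phi>_def[abs_def] o_def)
  qed
  have "inj \<Phi>"
    unfolding linear_injective_0[OF lin_\<Phi>]
  proof (intro allI impI)
    fix u assume "\<Phi> u = 0"
    then have "q (0, u) = 0" using \<rho>_inner[of "(0, u)" u] by (simp add: \<Phi>_def qb)
    then show "u = 0" using pos by force
  qed
  then obtain \<Psi> where lin_\<Psi>: "linear \<Psi>" and \<Phi>\<Psi>: "\<And>y. \<Phi> (\<Psi> y) = y"
    using linear_surjective_right_inverse[OF lin_\<Phi> linear_inj_imp_surj[OF lin_\<Phi>]]
    by (metis comp_apply id_apply)
  define L where "L p = \<Psi> (- \<rho> (p, 0))" for p
  have "linear L"
  proof -
    have "linear (\<lambda>p::'v. (p, 0::'u))" by (simp add: linear_iff)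
    from linear_compose[OF linear_compose[OF this lin_\<rho>] linear_compose[OF linear_uminus lin_\<Psi>]]
    show ?thesis by (simp add: L_def[abs_def] o_def)
  qed
  moreover have "q (p, L p) < q (p, u)" if "u \<noteq> L p" for p u
  proof -
    have stationary: "\<rho> (p, L p) = 0"
      using linear_add[OF lin_\<rho>, of "(p, 0)" "(0, L p)"] by (simp add: L_def \<Phi>\<Psi>[unfolded \<Phi>_def])
    define h where "h = u - L p"
    have "q (p, u) = b ((p, L p) + (0, h)) ((p, L p) + (0, h))"
      by (simp add: qb h_def)
    also have "\<dots> = b (p, L p) (p, L p) + b (p, L p) (0, h) + b (0, h) (p, L p) + b (0, h) (0, h)"
      by (simp only: bilinear_ladd[OF bil] bilinear_radd[OF bil] add.assoc)
    also have "\<dots> = q (p, L p) + q (0, h)"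
      using \<rho>_inner[of "(p, L p)" h] sym[of "(0, h)" "(p, L p)"] by (simp add: stationary qb)
    finally show ?thesis using pos[of h] that by (simp add: h_def)
  qed
  ultimately show thesis by (rule that)
qed

lemma quadratic_form_argmin:
  fixes q :: "'v::real_vector \<times> 'u::euclidean_space \<Rightarrow> real"
  assumes "quadratic_form q" and "\<And>u. u \<noteq> 0 \<Longrightarrow> 0 < q (0, u)"
  obtains L where "linear L" and "\<And>p. (SOME u. \<forall>w. q (p, u) \<le> q (p, w)) = L p"
    and "quadratic_form (\<lambda>p. q (p, L p))"
proof -
  obtain L where lin_L: "linear L" and min: "\<And>p u. u \<noteq> L p \<Longrightarrow> q (p, L p) < q (p, u)"
    using quadratic_form_partial_minimizer[OF assms] by blast
  have "(SOME u. \<forall>w. q (p, u) \<le> q (p, w)) = L p" for p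
  proof (rule some_equality)
    show "\<forall>w. q (p, L p) \<le> q (p, w)"
      using min by (metis order.strict_implies_order order_refl)
    show "u = L p" if "\<forall>w. q (p, u) \<le> q (p, w)" for u
      using that min[of u p] by (metis not_less)
  qed
  moreover have "linear (\<lambda>p. (p, L p))"
    using lin_L by (simp add: linear_iff)
  ultimately show thesis
    using lin_L quadratic_form_compose[OF assms(1)] that by blast
qed

(* The term f 0 lets invariant summands cancel without assuming they vanish at 0. *)
definition second_difference :: "('a::real_vector \<Rightarrow> real) \<Rightarrow> 'a \<Rightarrow> 'a \<Rightarrow> real" where
  "second_difference f v w = f (v + w) - f v - f w + f 0"

lemma second_difference_commute: "second_difference f v w = second_difference f w v"
  by (simp add: second_difference_def add.commute)

lemma second_difference_eq_0_if_invariant: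
  assumes "\<And>z. F z = f z + g z" and "\<And>z. f (z + v) = f z" and "\<And>z. g (z + w) = g z"
  shows "second_difference F v w = 0"
proof -
  have "f (v + w) = f w" "f v = f 0" "g (v + w) = g v" "g w = g 0"
    using assms(2)[of w] assms(2)[of 0] assms(3)[of v] assms(3)[of 0] by (simp_all add: add.commute)
  then show ?thesis by (simp add: second_difference_def assms(1))
qed

lemma quadratic_form_sum_expansion:
  assumes "quadratic_form q" and "finite S"
  shows "q (\<Sum>a\<in>S. c a *\<^sub>R e a)
    = 1/2 * (\<Sum>a\<in>S. \<Sum>a'\<in>S. c a * second_difference q (e a) (e a') * c a')"
proof -
  obtain b where bil: "bilinear b" and sym: "\<And>v w. b v w = b w v" and qb: "\<And>v. q v = b v v"
    using quadratic_form_symmetric[OF assms(1)] by blast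
  have "second_difference q v w = 2 * b v w" for v w
    by (simp add: second_difference_def qb bilinear_ladd[OF bil] bilinear_radd[OF bil]
        bilinear_lzero[OF bil] sym[of w v])
  moreover have "q (\<Sum>a\<in>S. c a *\<^sub>R e a) = (\<Sum>a\<in>S. \<Sum>a'\<in>S. c a * b (e a) (e a') * c a')"
    by (simp add: qb bilinear_sum[OF bil] sum.cartesian_product bilinear_lmul[OF bil]
        bilinear_rmul[OF bil] case_prod_beta mult_ac)
  ultimately show ?thesis
    by (simp add: sum_distrib_left mult.assoc mult.left_commute)
qed

definition tracking_cost :: "real^'n^'n \<Rightarrow> real^'n \<Rightarrow> real^'n \<Rightarrow> real" where
  "tracking_cost Q x \<rho> = 1/2 * ((x - \<rho>) \<bullet> (Q *v (x - \<rho>)))"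

lemma cost_eq_tracking_cost: "cost Q R x u \<rho> = tracking_cost Q x \<rho> + 1/2 * (u \<bullet> (R *v u))"
  by (simp add: cost_def tracking_cost_def algebra_simps)

lemma cost_nonneg:
  assumes "psd Q" and "pd R"
  shows "0 \<le> cost Q R x u \<rho>"
proof -
  have "0 \<le> (x - \<rho>) \<bullet> (Q *v (x - \<rho>))"
    using assms(1) psd_def by blast
  moreover have "0 \<le> u \<bullet> (R *v u)"
    using assms(2) unfolding pd_def by (cases "u = 0") (auto intro: less_imp_le)
  ultimately show ?thesis by (simp add: cost_def)
qed

lemma cost_quadratic_form: "quadratic_form (\<lambda>((x, r), u). cost Q R x u (r \<kappa>))"
  unfolding cost_def split_def
  by (intro quadratic_form_cmult quadratic_form_add quadratic_form_compose[OF quadratic_form_matrix])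
     (auto simp: linear_iff algebra_simps)

lemma Qrec_nonneg:
  assumes "psd Q" and "pd R" and "0 \<le> \<gamma>"
  shows "0 \<le> Qrec A B Q R \<gamma> d \<kappa> x u r"
  using assms
  by (induct d arbitrary: \<kappa> x u) (auto simp: Let_def cost_nonneg)

lemma Qrec_pos:
  assumes "psd Q" and "pd R" and "0 \<le> \<gamma>" and "u \<noteq> 0"
  shows "0 < Qrec A B Q R \<gamma> d \<kappa> 0 u 0"
proof -
  have "0 < cost Q R 0 u 0"
    using assms(2,4) unfolding pd_def cost_def by simp
  then show ?thesis
    using Qrec_nonneg[OF assms(1-3)] assms(3)
    by (cases d) (auto simp: Let_def intro!: add_pos_nonneg)
qed

lemma Qrec_quadratic_form:
  fixes A :: "real^'n^'n" and B :: "real^'m^'n"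
  assumes "psd Q" and "pd R" and "0 \<le> \<gamma>"
  shows "quadratic_form (\<lambda>((x, r), u). Qrec A B Q R \<gamma> d \<kappa> x u r)"
proof (induction d arbitrary: \<kappa>)
  case 0
  show ?case by (simp add: cost_quadratic_form)
next
  case (Suc d)
  define q where "q = (\<lambda>((x, r), u). Qrec A B Q R \<gamma> d (Suc \<kappa>) x u r)"
  have "\<And>u. u \<noteq> 0 \<Longrightarrow> 0 < q (0, u)"
    using Qrec_pos[OF assms] by (simp add: q_def zero_prod_def)
  then obtain L where argmin: "\<And>p. (SOME u. \<forall>w. q (p, u) \<le> q (p, w)) = L p"
    and quad_L: "quadratic_form (\<lambda>p. q (p, L p))"
    using quadratic_form_argmin[OF Suc.IH[of "Suc \<kappa>", folded q_def]] by blast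
  define T where "T = (\<lambda>((x, r :: nat \<Rightarrow> real^'n), u). (A *v x + B *v u, r))"
  have "linear T"
    by (auto simp: T_def linear_iff matrix_vector_right_distrib matrix_vector_mult_scaleR scaleR_add_right)
  have "(\<lambda>((x, r), u). Qrec A B Q R \<gamma> (Suc d) \<kappa> x u r)
      = (\<lambda>z. (\<lambda>((x, r), u). cost Q R x u (r \<kappa>)) z + \<gamma> * q (T z, L (T z)))"
    using argmin by (auto simp: q_def T_def Let_def)
  then show ?case
    by (simp only:) (intro quadratic_form_add quadratic_form_cmult cost_quadratic_form
        quadratic_form_compose[OF quad_L \<open>linear T\<close>])
qed

lemma Qrec_cong_refs:
  assumes "\<And>j. \<kappa> \<le> j \<Longrightarrow> r j = r' j"
  shows "Qrec A B Q R \<gamma> d \<kappa> x u r = Qrec A B Q R \<gamma> d \<kappa> x u r'"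
  using assms
proof (induction d arbitrary: \<kappa> x u)
  case 0
  then show ?case by simp
next
  case (Suc d)
  have "Qrec A B Q R \<gamma> d (Suc \<kappa>) y v r = Qrec A B Q R \<gamma> d (Suc \<kappa>) y v r'" for y v
    using Suc by simp
  then show ?case using Suc.prems[of \<kappa>] by (simp add: Let_def)
qed

lemma Qrec_minus_tracking_cost_cong:
  assumes "\<And>j. \<kappa> < j \<Longrightarrow> r j = r' j"
  shows "Qrec A B Q R \<gamma> d \<kappa> x u r - tracking_cost Q x (r \<kappa>)
       = Qrec A B Q R \<gamma> d \<kappa> x u r' - tracking_cost Q x (r' \<kappa>)"
proof (cases d)
  case 0
  then show ?thesis by (simp add: cost_eq_tracking_cost)
next
  case (Suc d')
  have "Qrec A B Q R \<gamma> d' (Suc \<kappa>) y v r = Qrec A B Q R \<gamma> d' (Suc \<kappa>) y v r'" for y v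
    using assms by (intro Qrec_cong_refs) simp
  then show ?thesis using Suc by (simp add: Let_def cost_eq_tracking_cost)
qed

lemma Qrec_argmin_cong:
  assumes "\<And>j. \<kappa> < j \<Longrightarrow> r j = r' j"
  shows "(SOME v. \<forall>w. Qrec A B Q R \<gamma> d \<kappa> x v r \<le> Qrec A B Q R \<gamma> d \<kappa> x w r)
       = (SOME v. \<forall>w. Qrec A B Q R \<gamma> d \<kappa> x v r' \<le> Qrec A B Q R \<gamma> d \<kappa> x w r')"
proof -
  have "Qrec A B Q R \<gamma> d \<kappa> x v r - tracking_cost Q x (r \<kappa>)
      = Qrec A B Q R \<gamma> d \<kappa> x v r' - tracking_cost Q x (r' \<kappa>)" for v
    using assms by (rule Qrec_minus_tracking_cost_cong)
  then have "Qrec A B Q R \<gamma> d \<kappa> x v r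
      = Qrec A B Q R \<gamma> d \<kappa> x v r' + (tracking_cost Q x (r \<kappa>) - tracking_cost Q x (r' \<kappa>))" for v
    by (simp add: algebra_simps)
  then show ?thesis by simp
qed

lemma Q0_minus_tracking_cost_cong:
  assumes "\<And>j. 0 < j \<Longrightarrow> r j = r' j"
  shows "Q0 A B Q R \<gamma> K x u r - tracking_cost Q x (r 0) = Q0 A B Q R \<gamma> K x u r' - tracking_cost Q x (r' 0)"
  unfolding Q0_def using assms by (rule Qrec_minus_tracking_cost_cong)

lemma Q0_minus_two_stage_costs_cong:
  assumes "0 < K" and "\<And>j. 1 < j \<Longrightarrow> r j = r' j"
  shows "Q0 A B Q R \<gamma> K x u r - cost Q R x u (r 0) - \<gamma> * tracking_cost Q (A *v x + B *v u) (r 1)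
       = Q0 A B Q R \<gamma> K x u r' - cost Q R x u (r' 0) - \<gamma> * tracking_cost Q (A *v x + B *v u) (r' 1)"
proof -
  obtain K' where K: "K = Suc K'" using \<open>0 < K\<close> by (cases K) auto
  let ?y = "A *v x + B *v u"
  have "Qrec A B Q R \<gamma> K' 1 ?y v r - tracking_cost Q ?y (r 1)
      = Qrec A B Q R \<gamma> K' 1 ?y v r' - tracking_cost Q ?y (r' 1)" for v
    using assms(2) by (rule Qrec_minus_tracking_cost_cong)
  moreover have "(SOME v. \<forall>w. Qrec A B Q R \<gamma> K' 1 ?y v r \<le> Qrec A B Q R \<gamma> K' 1 ?y w r)
      = (SOME v. \<forall>w. Qrec A B Q R \<gamma> K' 1 ?y v r' \<le> Qrec A B Q R \<gamma> K' 1 ?y w r')"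
    using assms(2) by (rule Qrec_argmin_cong)
  ultimately show ?thesis
    by (simp add: K Q0_def Let_def right_diff_distrib[symmetric])
qed

fun blk_unit :: "('n::finite, 'm::finite) blk \<Rightarrow> (real^'n) \<times> (real^'m) \<times> (nat \<Rightarrow> real^'n)" where
  "blk_unit (Bx i) = (axis i 1, 0, 0)"
| "blk_unit (Bu j) = (0, axis j 1, 0)"
| "blk_unit (Br l i) = (0, 0, 0(l := axis i 1))"

lemma blkset_eq: "blkset K = (range Bx \<union> range Bu) \<union> case_prod Br ` ({..K} \<times> UNIV)"
  unfolding blkset_def by auto

lemma finite_blkset: "finite (blkset K :: ('n::finite, 'm::finite) blk set)"
  by (simp add: blkset_eq)

lemma sum_blkset:
  fixes g :: "('n::finite, 'm::finite) blk \<Rightarrow> 'a::comm_monoid_add"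
  shows "(\<Sum>a\<in>blkset K. g a)
    = (\<Sum>i\<in>UNIV. g (Bx i)) + (\<Sum>j\<in>UNIV. g (Bu j)) + (\<Sum>l\<le>K. \<Sum>i\<in>UNIV. g (Br l i))"
proof -
  have "(\<Sum>a\<in>blkset K. g a)
      = (\<Sum>a\<in>range Bx. g a) + (\<Sum>a\<in>range Bu. g a) + (\<Sum>a\<in>case_prod Br ` ({..K} \<times> UNIV). g a)"
    unfolding blkset_eq by (subst sum.union_disjoint; auto)+
  then show ?thesis
    by (simp add: sum.reindex inj_on_def sum.cartesian_product split_def)
qed

lemma stack_expansion:
  fixes x :: "real^'n::finite" and u :: "real^'m::finite"
  assumes "\<And>j. K < j \<Longrightarrow> r j = 0"
  shows "(\<Sum>a\<in>blkset K. stack x u r a *\<^sub>R blk_unit a) = (x, u, r)"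
proof -
  have "(\<Sum>l\<le>K. \<Sum>i\<in>UNIV. r l $ i *\<^sub>R (0(l := axis i 1)) k) = r k" for k
  proof (cases "k \<le> K")
    case True
    have "(\<Sum>i\<in>UNIV. r l $ i *\<^sub>R (0(l := axis i 1)) k) = (if l = k then r l else 0)" for l
      using basis_expansion[of "r l"] by (auto simp: scalar_mult_eq_scaleR)
    with True show ?thesis by simp
  next
    case False
    then show ?thesis using assms[of k] by simp
  qed
  then show ?thesis
    using basis_expansion[of x] basis_expansion[of u]
    by (simp add: sum_blkset prod_eq_iff fst_sum snd_sum fun_eq_iff sum_fun_apply scalar_mult_eq_scaleR)
qed

lemma Q0_quadratic_form:
  fixes A :: "real^'n::finite^'n" and B :: "real^'m::finite^'n"
  assumes "psd Q" and "pd R" and "0 \<le> \<gamma>"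
  shows "quadratic_form (\<lambda>(x, u, r). Q0 A B Q R \<gamma> K x u r)"
proof -
  have "linear (\<lambda>(x :: real^'n, u :: real^'m, r :: nat \<Rightarrow> real^'n). ((x, r), u))"
    by (simp add: linear_iff split_def)
  from quadratic_form_compose[OF Qrec_quadratic_form[OF assms] this]
  show ?thesis by (simp add: Q0_def split_def)
qed

definition Q0_hessian ::
    "real^'n^'n \<Rightarrow> real^'m^'n \<Rightarrow> real^'n^'n \<Rightarrow> real^'m^'m \<Rightarrow> real \<Rightarrow> nat
      \<Rightarrow> ('n::finite, 'm::finite) blk \<Rightarrow> ('n, 'm) blk \<Rightarrow> real" where
  "Q0_hessian A B Q R \<gamma> K a c =
     second_difference (\<lambda>(x, u, r). Q0 A B Q R \<gamma> K x u r) (blk_unit a) (blk_unit c)"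

lemma Q0_hessian_symmetric: "Q0_hessian A B Q R \<gamma> K a c = Q0_hessian A B Q R \<gamma> K c a"
  by (simp add: Q0_hessian_def second_difference_commute)

lemma Q0_eq_qform_hessian:
  fixes A :: "real^'n::finite^'n" and B :: "real^'m::finite^'n"
  assumes "psd Q" and "pd R" and "0 \<le> \<gamma>" and "\<And>j. K < j \<Longrightarrow> r j = 0"
  shows "Q0 A B Q R \<gamma> K x u r = 1/2 * qform K (Q0_hessian A B Q R \<gamma> K) (stack x u r)"
proof -
  have "Q0 A B Q R \<gamma> K x u r
      = (\<lambda>(x, u, r). Q0 A B Q R \<gamma> K x u r) (\<Sum>a\<in>blkset K. stack x u r a *\<^sub>R blk_unit a)"
    by (simp add: stack_expansion[OF assms(4)])
  also have "\<dots> = 1/2 * qform K (Q0_hessian A B Q R \<gamma> K) (stack x u r)"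
    using quadratic_form_sum_expansion[OF Q0_quadratic_form[OF assms(1-3)] finite_blkset]
    by (simp add: Q0_hessian_def qform_def)
  finally show ?thesis .
qed

lemma Q0_hessian_u_r0:
  fixes A :: "real^'n::finite^'n" and B :: "real^'m::finite^'n"
  shows "Q0_hessian A B Q R \<gamma> K (Bu j) (Br 0 i) = 0"
proof -
  define f where "f = (\<lambda>(x :: real^'n, u :: real^'m, r :: nat \<Rightarrow> real^'n). tracking_cost Q x (r 0))"
  define g where "g = (\<lambda>(x, u, r). Q0 A B Q R \<gamma> K x u r - tracking_cost Q x (r 0))"
  have "f (z + blk_unit (Bu j)) = f z" for z
    by (simp add: f_def split_def)
  moreover have "g (z + blk_unit (Br 0 i)) = g z" for z
    using Q0_minus_tracking_cost_cong[where r = "snd (snd z) + 0(0 := axis i 1)" and r' = "snd (snd z)"]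
    by (simp add: g_def split_def)
  ultimately show ?thesis unfolding Q0_hessian_def
    by (intro second_difference_eq_0_if_invariant[of _ f g]) (simp_all add: f_def g_def split_def)
qed

lemma Q0_hessian_r0_r:
  fixes A :: "real^'n::finite^'n" and B :: "real^'m::finite^'n"
  assumes "0 < l"
  shows "Q0_hessian A B Q R \<gamma> K (Br 0 i) (Br l i') = 0"
proof -
  define f where "f = (\<lambda>(x, u, r). Q0 A B Q R \<gamma> K x u r - tracking_cost Q x (r 0))"
  define g where "g = (\<lambda>(x :: real^'n, u :: real^'m, r :: nat \<Rightarrow> real^'n). tracking_cost Q x (r 0))"
  have "f (z + blk_unit (Br 0 i)) = f z" for z
    using Q0_minus_tracking_cost_cong[where r = "snd (snd z) + 0(0 := axis i 1)" and r' = "snd (snd z)"]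
    by (simp add: f_def split_def)
  moreover have "g (z + blk_unit (Br l i')) = g z" for z
    using assms by (simp add: g_def split_def)
  ultimately show ?thesis unfolding Q0_hessian_def
    by (intro second_difference_eq_0_if_invariant[of _ f g]) (simp_all add: f_def g_def split_def)
qed

lemma Q0_hessian_r1_r:
  fixes A :: "real^'n::finite^'n" and B :: "real^'m::finite^'n"
  assumes "0 < K" and "l \<noteq> 1"
  shows "Q0_hessian A B Q R \<gamma> K (Br 1 i) (Br l i') = 0"
proof -
  define f where "f = (\<lambda>(x, u, r). Q0 A B Q R \<gamma> K x u r - \<gamma> * tracking_cost Q (A *v x + B *v u) (r 1))"
  define g where "g = (\<lambda>(x, u, r :: nat \<Rightarrow> real^'n). \<gamma> * tracking_cost Q (A *v x + B *v u) (r 1))"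
  have "f (z + blk_unit (Br 1 i)) = f z" for z
    using Q0_minus_two_stage_costs_cong[OF assms(1), where r = "snd (snd z) + 0(1 := axis i 1)"
        and r' = "snd (snd z)"]
    by (simp add: f_def split_def)
  moreover have "g (z + blk_unit (Br l i')) = g z" for z
    using assms(2) by (simp add: g_def split_def)
  ultimately show ?thesis unfolding Q0_hessian_def
    by (intro second_difference_eq_0_if_invariant[of _ f g]) (simp_all add: f_def g_def split_def)
qed

lemma Q0_hessian_r_r01:
  fixes A :: "real^'n::finite^'n" and B :: "real^'m::finite^'n"
  assumes "0 < K" and "2 \<le> l" and "l' \<le> 1"
  shows "Q0_hessian A B Q R \<gamma> K (Br l i) (Br l' i') = 0"
proof -
  define f where "f = (\<lambda>(x, u, r :: nat \<Rightarrow> real^'n).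
    cost Q R x u (r 0) + \<gamma> * tracking_cost Q (A *v x + B *v u) (r 1))"
  define g where "g = (\<lambda>(x, u, r).
    Q0 A B Q R \<gamma> K x u r - cost Q R x u (r 0) - \<gamma> * tracking_cost Q (A *v x + B *v u) (r 1))"
  have "f (z + blk_unit (Br l i)) = f z" for z
    using assms(2) by (simp add: f_def split_def)
  moreover have "g (z + blk_unit (Br l' i')) = g z" for z
  proof -
    from assms(3) consider "l' = 0" | "l' = 1" by linarith
    then show ?thesis
      using Q0_minus_two_stage_costs_cong[OF assms(1), where r = "snd (snd z) + 0(l' := axis i' 1)"
          and r' = "snd (snd z)"]
      by cases (simp_all add: g_def split_def)
  qed
  ultimately show ?thesis unfolding Q0_hessian_def
    by (intro second_difference_eq_0_if_invariant[of _ f g]) (simp_all add: f_def g_def split_def)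
qed

theorem theorem1:
  fixes A :: "real^'n::finite^'n" and B :: "real^'m::finite^'n"
    and Q :: "real^'n^'n" and R :: "real^'m^'m" and \<gamma> :: real and N K :: nat
  assumes "controllable A B"
    and "psd Q" and "pd R"
    and "0 \<le> \<gamma>" and "\<gamma> < 1"
    and "N \<le> K"
  shows "\<exists>H :: ('n, 'm) blk \<Rightarrow> ('n, 'm) blk \<Rightarrow> real.
     (\<forall>a\<in>blkset K. \<forall>b\<in>blkset K. H a b = H b a)
   \<and> (\<forall>j i. H (Bu j) (Br 0 i) = 0 \<and> H (Br 0 i) (Bu j) = 0)
   \<and> (\<forall>l i i'. 1 \<le> l \<and> l \<le> K \<longrightarrow> H (Br 0 i) (Br l i') = 0)
   \<and> (\<forall>l i i'. 1 \<le> K \<and> l \<le> K \<and> l \<noteq> 1 \<longrightarrow> H (Br 1 i) (Br l i') = 0)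
   \<and> (\<forall>l i i'. 2 \<le> l \<and> l \<le> K \<longrightarrow> H (Br l i) (Br 0 i') = 0 \<and> H (Br l i) (Br 1 i') = 0)
   \<and> (\<forall>(x :: real^'n) (u :: real^'m) (r :: nat \<Rightarrow> real^'n).
        (\<forall>j>N. r j = 0) \<longrightarrow>
        Q0 A B Q R \<gamma> K x u r = (1/2) * qform K H (stack x u r))"
proof (intro exI[of _ "Q0_hessian A B Q R \<gamma> K"] conjI allI impI ballI)
  let ?H = "Q0_hessian A B Q R \<gamma> K"
  show "?H a c = ?H c a" for a c
    by (rule Q0_hessian_symmetric)
  show "?H (Bu j) (Br 0 i) = 0" "?H (Br 0 i) (Bu j) = 0" for j i
    using Q0_hessian_u_r0 Q0_hessian_symmetric by metis+
  show "?H (Br 0 i) (Br l i') = 0" if "1 \<le> l \<and> l \<le> K" for l i i'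
    using that by (intro Q0_hessian_r0_r) simp
  show "?H (Br 1 i) (Br l i') = 0" if "1 \<le> K \<and> l \<le> K \<and> l \<noteq> 1" for l i i'
    using that by (intro Q0_hessian_r1_r) auto
  show "?H (Br l i) (Br 0 i') = 0" "?H (Br l i) (Br 1 i') = 0" if "2 \<le> l \<and> l \<le> K" for l i i'
    using that by (auto intro!: Q0_hessian_r_r01)
  show "Q0 A B Q R \<gamma> K x u r = 1/2 * qform K ?H (stack x u r)" if "\<forall>j>N. r j = 0" for x u r
    using assms(2-4) by (rule Q0_eq_qform_hessian) (use that assms(6) in simp)
qed

end
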